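(* Let $A:\mathbb{X}^\star\to\{C^0\prec\dots\prec C^{p-1}\}$ be an assignment. If the binary tuple consisting of $x_{i,h,k}$ (indexed by a criterion $i\in\mathcal{N}$, a frontier between classes $1\le h\le p-1$, and a value $k\in\mathbb{X}^\star_i$ taken on criterion $i$ by a reference alternative) and $y_B$ (indexed by a coalition of criteria $B\subseteq\mathcal{N}$) satisfies $\phi^{SAT}_A(x,y)=1$, then the profiles $\langle b\rangle=(b^1,\dots,b^{p-1})$ defined by $$b^h_i:=\min\{k\in\mathbb{X}^\star_i: x_{i,h,k}=1\}\qquad(i\in\mathcal{N},\ 1\le h\le p-1)$$ form a non-decreasing sequence of $\mathbb{X}$ for weak dominance (i.e. $b^1_i\le_i\dots\le_i b^{p-1}_i$ for all $i\in\mathcal{N}$), the set of coalitions $\mathcal{T}:=\{B\subseteq\mathcal{N}: y_B=1\}$ is an upset, and the sorting function $\text{U-NCS}_{(\langle b\rangle,\mathcal{T})}$ extends the assignment $A$.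
   Context: Setting. $\mathcal{N}$ is a finite set of criteria; for each $i\in\mathcal{N}$, $(\mathbb{X}_i,\le_i)$ is a totally ordered set; $\mathbb{X}=\prod_{i\in\mathcal{N}}\mathbb{X}_i$ is the set of profiles. A coalition is a subset of $\mathcal{N}$; an upset of coalitions is a family $\mathcal{T}\subseteq 2^{\mathcal{N}}$ such that $B\in\mathcal{T}$ and $B\subseteq B'\subseteq\mathcal{N}$ imply $B'\in\mathcal{T}$. For profiles $x,y$, $O_{\mathcal{N}}(x,y)=\{i\in\mathcal{N}: x_i\ge_i y_i\}$; $x$ weakly dominates $y$ when $O_{\mathcal{N}}(x,y)=\mathcal{N}$. There are $p$ ordered categories $C^0\prec C^1\prec\dots\prec C^{p-1}$; the limiting profile (frontier) $b^h$, $1\le h\le p-1$, separates $C^{h-1}$ from $C^h$. U-NCS. For a sequence $\langle b\rangle=(b^1,\dots,b^{p-1})$ of elements of $\mathbb{X}$ that is non-decreasing for weak dominance, and an upset of coalitions $\mathcal{T}$, the sorting function $\text{U-NCS}_{(\langle b\rangle,\mathcal{T})}$ maps a profile $x\in\mathbb{X}$ to the category $C^k$ ($0\le k\le p-1$) such that $O_{\mathcal{N}}(x,b^k)\in\mathcal{T}$ and $O_{\mathcal{N}}(x,b^{k+1})\notin\mathcal{T}$, where by convention the first condition is regarded as always true for $k=0$ and the second as always true for $k=p-1$. Assignment. $\mathbb{X}^\star\subset\mathbb{X}$ is a finite set of reference alternatives, $\mathbb{X}^\star_i=\{x_i:x\in\mathbb{X}^\star\}$, and an assignment $A$ is a function from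 $\mathbb{X}^\star$ to the set of categories. A sorting function extends $A$ if it coincides with $A$ on $\mathbb{X}^\star$. SAT encoding. $\phi^{SAT}_A$ is the Boolean function of the variables $x_{i,h,k}$ ($i\in\mathcal{N}$, $1\le h\le p-1$, $k\in\mathbb{X}^\star_i$) and $y_B$ ($B\subseteq\mathcal{N}$) given by the conjunction of the following clauses (an empty disjunction is false): (1) for all $i\in\mathcal{N}$, $1\le h\le p-1$, $k<k'$ in $\mathbb{X}^\star_i$: $x_{i,h,k'}\vee\neg x_{i,h,k}$; (2) for all $i\in\mathcal{N}$, $1\le h<h'\le p-1$, $k\in\mathbb{X}^\star_i$: $x_{i,h,k}\vee\neg x_{i,h',k}$; (3) for all $B\subset B'\subseteq\mathcal{N}$: $y_{B'}\vee\neg y_B$; (4) for all $B\subseteq\mathcal{N}$, $1\le h\le p-1$, $u\in\mathbb{X}^\star$ with $A(u)=C^{h-1}$: $(\bigvee_{i\in B}\neg x_{i,h,u_i})\vee\neg y_B$; (5) for all $B\subseteq\mathcal{N}$, $1\le h\le p-1$, $a\in\mathbb{X}^\star$ with $A(a)=C^{h}$: $(\bigvee_{i\in B}x_{i,h,a_i})\vee y_{\mathcal{N}\setminus B}$.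
   Formalization: The minimum defining a frontier value is undefined when no reference value on criterion i has x_{i,h,k}=1 (possible, e.g. if A is constantly C^0); in that case b^h_i is taken to be a value of X_i assumed to lie strictly above all reference values on criterion i. *)

theory Defs
  imports Main "HOL-Library.FuncSet"
begin

text \<open>
  Criteria are the elements of a set \<open>N\<close>. The totally ordered set attached to criterion \<open>i\<close> is
  given by its carrier \<open>X i\<close> and its (reflexive) order relation \<open>R i\<close>, both over one common
  value type; \<open>(a, b) \<in> R i\<close> reads: \<open>a\<close> is at most \<open>b\<close> on criterion \<open>i\<close>.
  Profiles are the elements of \<open>PiE N X\<close>. The category \<open>C^k\<close> is represented by the number
  \<open>k < p\<close>.
\<close>

definition outranking_coalition ::
  "'i set \<Rightarrow> ('i \<Rightarrow> 'v rel) \<Rightarrow> ('i \<Rightarrow> 'v) \<Rightarrow> ('i \<Rightarrow> 'v) \<Rightarrow> 'i set" where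
  "outranking_coalition N R x y = {i \<in> N. (y i, x i) \<in> R i}"

definition weakly_dominates ::
  "'i set \<Rightarrow> ('i \<Rightarrow> 'v rel) \<Rightarrow> ('i \<Rightarrow> 'v) \<Rightarrow> ('i \<Rightarrow> 'v) \<Rightarrow> bool" where
  "weakly_dominates N R x y \<longleftrightarrow> outranking_coalition N R x y = N"

definition upset_of_coalitions :: "'i set \<Rightarrow> 'i set set \<Rightarrow> bool" where
  "upset_of_coalitions N T \<longleftrightarrow>
     T \<subseteq> Pow N \<and> (\<forall>B B'. B \<in> T \<longrightarrow> B \<subseteq> B' \<longrightarrow> B' \<subseteq> N \<longrightarrow> B' \<in> T)"

text \<open>Only the entries \<open>b 1, \<dots>, b (p - 1)\<close> of the sequence matter.\<close>

definition nondecreasing_profiles ::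
  "'i set \<Rightarrow> ('i \<Rightarrow> 'v set) \<Rightarrow> ('i \<Rightarrow> 'v rel) \<Rightarrow> nat \<Rightarrow> (nat \<Rightarrow> 'i \<Rightarrow> 'v) \<Rightarrow> bool" where
  "nondecreasing_profiles N X R p b \<longleftrightarrow>
     (\<forall>h \<in> {1..p-1}. b h \<in> PiE N X) \<and>
     (\<forall>h \<in> {1..p-1}. \<forall>h' \<in> {1..p-1}. h \<le> h' \<longrightarrow> weakly_dominates N R (b h') (b h))"

definition U_NCS ::
  "'i set \<Rightarrow> ('i \<Rightarrow> 'v rel) \<Rightarrow> nat \<Rightarrow> (nat \<Rightarrow> 'i \<Rightarrow> 'v) \<Rightarrow> 'i set set \<Rightarrow> ('i \<Rightarrow> 'v) \<Rightarrow> nat" where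
  "U_NCS N R p b T x =
     (THE k. k < p \<and>
        (k = 0 \<or> outranking_coalition N R x (b k) \<in> T) \<and>
        (k = p - 1 \<or> outranking_coalition N R x (b (k + 1)) \<notin> T))"

text \<open>The description in \<open>U_NCS_def\<close> always determines exactly one category.\<close>

lemma U_NCS_unique:
  assumes R: "\<And>i. i \<in> N \<Longrightarrow> linear_order_on (X i) (R i)"
    and p: "1 \<le> p"
    and b: "nondecreasing_profiles N X R p b"
    and T: "upset_of_coalitions N T"
  shows "\<exists>!k. k < p \<and>
        (k = 0 \<or> outranking_coalition N R x (b k) \<in> T) \<and>
        (k = p - 1 \<or> outranking_coalition N R x (b (k + 1)) \<notin> T)"
proof -
  let ?P = "\<lambda>k. k = 0 \<or> outranking_coalition N R x (b k) \<in> T"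
  have down: "?P h" if "?P h'" "h \<le> h'" "h' < p" for h h'
  proof (cases "h = 0")
    case False
    then have h: "h \<in> {1..p-1}" "h' \<in> {1..p-1}" using that by auto
    then have "weakly_dominates N R (b h') (b h)"
      using b that unfolding nondecreasing_profiles_def by blast
    then have "(b h i, b h' i) \<in> R i" if "i \<in> N" for i
      using that unfolding weakly_dominates_def outranking_coalition_def by blast
    then have "outranking_coalition N R x (b h') \<subseteq> outranking_coalition N R x (b h)"
      using R unfolding outranking_coalition_def order_on_defs trans_def by blast
    moreover have "outranking_coalition N R x (b h) \<subseteq> N"
      by (auto simp: outranking_coalition_def)
    ultimately show ?thesis using T that False h unfolding upset_of_coalitions_def
      by (metis atLeastAtMost_iff not_one_le_zero)
  qed simp
  define m where "m = Max {k. k < p \<and> ?P k}"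
  have fin: "finite {k. k < p \<and> ?P k}" by simp
  have "0 \<in> {k. k < p \<and> ?P k}" using p by simp
  then have m: "m < p" "?P m" using Max_in[OF fin] unfolding m_def by blast+
  have mx: "k \<le> m" if "k < p" "?P k" for k
    unfolding m_def using that by (intro Max_ge[OF fin]) simp
  show ?thesis
  proof (rule ex1I[of _ m])
    have "m = p - 1 \<or> outranking_coalition N R x (b (m + 1)) \<notin> T"
      using mx[of "m + 1"] m(1) by (cases "m + 1 < p") auto
    then show "m < p \<and> ?P m \<and> (m = p - 1 \<or> outranking_coalition N R x (b (m + 1)) \<notin> T)"
      using m by blast
  next
    fix k
    assume k: "k < p \<and> ?P k \<and> (k = p - 1 \<or> outranking_coalition N R x (b (k + 1)) \<notin> T)"
    then have "k \<le> m" using mx by blast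
    moreover have "\<not> k < m"
    proof
      assume "k < m"
      then have "?P (k + 1)" using down[of m "k + 1"] m by simp
      then show False using k \<open>k < m\<close> m(1) by auto
    qed
    ultimately show "k = m" by simp
  qed
qed

definition extends_assignment ::
  "(('i \<Rightarrow> 'v) \<Rightarrow> nat) \<Rightarrow> ('i \<Rightarrow> 'v) set \<Rightarrow> (('i \<Rightarrow> 'v) \<Rightarrow> nat) \<Rightarrow> bool" where
  "extends_assignment f Xs A \<longleftrightarrow> (\<forall>u \<in> Xs. f u = A u)"

definition values_on :: "('i \<Rightarrow> 'v) set \<Rightarrow> 'i \<Rightarrow> 'v set" where
  "values_on Xs i = (\<lambda>u. u i) ` Xs"

definition phi_SAT ::
  "'i set \<Rightarrow> ('i \<Rightarrow> 'v rel) \<Rightarrow> nat \<Rightarrow> ('i \<Rightarrow> 'v) set \<Rightarrow> (('i \<Rightarrow> 'v) \<Rightarrow> nat) \<Rightarrow>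
   ('i \<Rightarrow> nat \<Rightarrow> 'v \<Rightarrow> bool) \<Rightarrow> ('i set \<Rightarrow> bool) \<Rightarrow> bool" where
  "phi_SAT N R p Xs A x y \<longleftrightarrow>
     (\<forall>i \<in> N. \<forall>h \<in> {1..p-1}. \<forall>k \<in> values_on Xs i. \<forall>k' \<in> values_on Xs i.
        (k, k') \<in> R i \<and> k \<noteq> k' \<longrightarrow> x i h k' \<or> \<not> x i h k) \<and>
     (\<forall>i \<in> N. \<forall>h \<in> {1..p-1}. \<forall>h' \<in> {1..p-1}. \<forall>k \<in> values_on Xs i.
        h < h' \<longrightarrow> x i h k \<or> \<not> x i h' k) \<and>
     (\<forall>B B'. B \<subset> B' \<and> B' \<subseteq> N \<longrightarrow> y B' \<or> \<not> y B) \<and>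
     (\<forall>B. B \<subseteq> N \<longrightarrow> (\<forall>h \<in> {1..p-1}. \<forall>u \<in> Xs.
        A u = h - 1 \<longrightarrow> (\<exists>i \<in> B. \<not> x i h (u i)) \<or> \<not> y B)) \<and>
     (\<forall>B. B \<subseteq> N \<longrightarrow> (\<forall>h \<in> {1..p-1}. \<forall>a \<in> Xs.
        A a = h \<longrightarrow> (\<exists>i \<in> B. x i h (a i)) \<or> y (N - B)))"

definition minimum_wrt :: "'v rel \<Rightarrow> 'v set \<Rightarrow> 'v" where
  "minimum_wrt r S = (THE k. k \<in> S \<and> (\<forall>k' \<in> S. (k, k') \<in> r))"

definition selected_values ::
  "('i \<Rightarrow> 'v) set \<Rightarrow> ('i \<Rightarrow> nat \<Rightarrow> 'v \<Rightarrow> bool) \<Rightarrow> 'i \<Rightarrow> nat \<Rightarrow> 'v set" where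
  "selected_values Xs x i h = {k \<in> values_on Xs i. x i h k}"

text \<open>
  No clause of \<open>phi_SAT\<close> forces \<open>selected_values Xs x i h\<close> to be nonempty. The argument \<open>tp\<close>
  is the value given to the minimum of the empty set on each criterion; it plays the role of
  plus infinity, i.e. \<open>tp i\<close> is meant to be a value in \<open>X i\<close> strictly above \<open>values_on Xs i\<close>.
  It is irrelevant wherever the set is nonempty.
\<close>

definition SAT_frontiers ::
  "'i set \<Rightarrow> ('i \<Rightarrow> 'v rel) \<Rightarrow> ('i \<Rightarrow> 'v) set \<Rightarrow> ('i \<Rightarrow> 'v) \<Rightarrow> ('i \<Rightarrow> nat \<Rightarrow> 'v \<Rightarrow> bool) \<Rightarrow>
   nat \<Rightarrow> 'i \<Rightarrow> 'v" where
  "SAT_frontiers N R Xs tp x h =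
     (\<lambda>i \<in> N. if selected_values Xs x i h = {} then tp i
              else minimum_wrt (R i) (selected_values Xs x i h))"

end

theory Submission
  imports Defs
begin

text \<open>
  On the values occurring in the reference set, clause (1) makes \<open>x i h\<close> the indicator of being
  at least the minimum \<open>b\<^sup>h\<^sub>i\<close>. Hence \<open>x i h (u i)\<close> holds exactly when \<open>u\<close> outranks \<open>b\<^sup>h\<close> on
  criterion \<open>i\<close>. Clause (5), applied to the complement of the outranking coalition \<open>O\<close> of \<open>u\<close> and
  \<open>b\<^sup>h\<close>, then gives \<open>O \<in> T\<close> when \<open>A u = h\<close>, and clause (4), applied to \<open>O\<close> itself, gives \<open>O \<notin> T\<close>
  when \<open>A u = h - 1\<close>.
\<close>

lemma linear_order_on_finite_has_minimum:
  assumes r: "linear_order_on V r"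
    and S: "finite S" "S \<noteq> {}" "S \<subseteq> V"
  shows "\<exists>m \<in> S. \<forall>k \<in> S. (m, k) \<in> r"
  using S
proof (induction S rule: finite_ne_induct)
  case (singleton a)
  then show ?case using r by (auto simp: order_on_defs refl_on_def)
next
  case (insert a S)
  then obtain m where m: "m \<in> S" "\<forall>k \<in> S. (m, k) \<in> r" by auto
  \<comment> \<open>Totality compares only distinct elements; the reflexive pairs cover a possible
    \<open>a = m\<close>.\<close>
  have aV: "(a, a) \<in> r" "a \<in> V" "m \<in> V" "(m, m) \<in> r"
    using r insert.prems m(1) by (auto simp: order_on_defs refl_on_def)
  then consider "(a, m) \<in> r" | "(m, a) \<in> r"
    using r unfolding order_on_defs total_on_def by metis
  then show ?case
  proof cases
    case 1
    then have "\<forall>k \<in> S. (a, k) \<in> r"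
      using r m unfolding order_on_defs trans_def by blast
    then show ?thesis using aV by blast
  next
    case 2
    then show ?thesis using m by blast
  qed
qed

lemma minimum_wrt_eqI:
  assumes "antisym r" "m \<in> S" "\<And>k. k \<in> S \<Longrightarrow> (m, k) \<in> r"
  shows "minimum_wrt r S = m"
  unfolding minimum_wrt_def using assms by (auto dest: antisymD)

text \<open>Finiteness and totality give existence, antisymmetry gives uniqueness, so the
  description in \<open>minimum_wrt\<close> denotes a genuine minimum.\<close>

lemma minimum_wrt_linear_order:
  assumes r: "linear_order_on V r" and S: "finite S" "S \<noteq> {}" "S \<subseteq> V"
  shows "minimum_wrt r S \<in> S" and "k \<in> S \<Longrightarrow> (minimum_wrt r S, k) \<in> r"
proof -
  obtain m where m: "m \<in> S" "\<forall>k \<in> S. (m, k) \<in> r"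
    using linear_order_on_finite_has_minimum[OF r S] by blast
  then have "minimum_wrt r S = m"
    using r by (intro minimum_wrt_eqI) (auto simp: order_on_defs)
  then show "minimum_wrt r S \<in> S" and "k \<in> S \<Longrightarrow> (minimum_wrt r S, k) \<in> r"
    using m by auto
qed

text \<open>Uniqueness of the category reduces the evaluation of \<open>U_NCS\<close> to two
  membership checks, each asked only where the boundary convention does not settle it.\<close>

lemma U_NCS_eqI:
  assumes "\<And>i. i \<in> N \<Longrightarrow> linear_order_on (X i) (R i)"
    and "1 \<le> p"
    and "nondecreasing_profiles N X R p b"
    and "upset_of_coalitions N T"
    and "k < p"
    and "k \<noteq> 0 \<Longrightarrow> outranking_coalition N R x (b k) \<in> T"
    and "k \<noteq> p - 1 \<Longrightarrow> outranking_coalition N R x (b (k + 1)) \<notin> T"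
  shows "U_NCS N R p b T x = k"
  unfolding U_NCS_def
proof (rule the1_equality)
  show "\<exists>!k. k < p \<and>
        (k = 0 \<or> outranking_coalition N R x (b k) \<in> T) \<and>
        (k = p - 1 \<or> outranking_coalition N R x (b (k + 1)) \<notin> T)"
    by (rule U_NCS_unique[OF assms(1-4)])
qed (use assms(5-7) in blast)

theorem theorem2:
  fixes N :: "'i set"
    and X :: "'i \<Rightarrow> 'v set"
    and R :: "'i \<Rightarrow> 'v rel"
    and p :: nat
    and Xs :: "('i \<Rightarrow> 'v) set"
    and A :: "('i \<Rightarrow> 'v) \<Rightarrow> nat"
    and x :: "'i \<Rightarrow> nat \<Rightarrow> 'v \<Rightarrow> bool"
    and y :: "'i set \<Rightarrow> bool"
    and tp :: "'i \<Rightarrow> 'v"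
  assumes "finite N"
    and "\<And>i. i \<in> N \<Longrightarrow> linear_order_on (X i) (R i)"
    and "1 \<le> p"
    and "finite Xs"
    and "Xs \<subseteq> PiE N X"
    and "A \<in> Xs \<rightarrow> {..<p}"
    and "\<And>i h. \<lbrakk>i \<in> N; h \<in> {1..p-1}; selected_values Xs x i h = {}\<rbrakk> \<Longrightarrow>
           tp i \<in> X i \<and> (\<forall>k \<in> values_on Xs i. (k, tp i) \<in> R i \<and> k \<noteq> tp i)"
    and "phi_SAT N R p Xs A x y"
  shows "nondecreasing_profiles N X R p (SAT_frontiers N R Xs tp x) \<and>
         upset_of_coalitions N {B. B \<subseteq> N \<and> y B} \<and>
         extends_assignment
           (U_NCS N R p (SAT_frontiers N R Xs tp x) {B. B \<subseteq> N \<and> y B}) Xs A"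
proof -
  note lin = assms(2) and tp = assms(7)
  define b where "b = SAT_frontiers N R Xs tp x"
  define sel where "sel = selected_values Xs x"
  define T where "T = {B. B \<subseteq> N \<and> y B}"
  note clauses = assms(8)[unfolded phi_SAT_def]
  note clause1 = clauses[THEN conjunct1]
    and clause2 = clauses[THEN conjunct2, THEN conjunct1]
    and clause3 = clauses[THEN conjunct2, THEN conjunct2, THEN conjunct1]
    and clause4 = clauses[THEN conjunct2, THEN conjunct2, THEN conjunct2, THEN conjunct1]
    and clause5 = clauses[THEN conjunct2, THEN conjunct2, THEN conjunct2, THEN conjunct2]
  have upward: "x i h k'"
    if "i \<in> N" "h \<in> {1..p-1}" "k \<in> values_on Xs i" "k' \<in> values_on Xs i"
      "(k, k') \<in> R i" "x i h k" for i h k k'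
    using bspec[OF bspec[OF bspec[OF bspec[OF clause1 that(1)] that(2)] that(3)] that(4)] that(5,6)
    by blast
  have frontier_mono: "x i h k"
    if "i \<in> N" "h \<in> {1..p-1}" "h' \<in> {1..p-1}" "k \<in> values_on Xs i" "h < h'" "x i h' k"
    for i h h' k
    using bspec[OF bspec[OF bspec[OF bspec[OF clause2 that(1)] that(2)] that(3)] that(4)] that(5,6)
    by blast
  have coalition_mono: "y B'" if "B \<subseteq> B'" "B' \<subseteq> N" "y B" for B B'
    using clause3[rule_format, of B B'] that by (cases "B = B'") auto
  have below: "(\<exists>i \<in> B. \<not> x i h (u i)) \<or> \<not> y B"
    if "B \<subseteq> N" "h \<in> {1..p-1}" "u \<in> Xs" "A u = h - 1" for B h u
    using clause4[rule_format, OF that] .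
  have above: "(\<exists>i \<in> B. x i h (a i)) \<or> y (N - B)"
    if "B \<subseteq> N" "h \<in> {1..p-1}" "a \<in> Xs" "A a = h" for B h a
    using clause5[rule_format, OF that] .

  have vals: "values_on Xs i \<subseteq> X i" "finite (values_on Xs i)" if "i \<in> N" for i
    using that assms(4,5) unfolding values_on_def by (auto simp: PiE_iff)
  have sel_sub: "sel i h \<subseteq> values_on Xs i" for i h
    by (auto simp: sel_def selected_values_def)
  have b_empty: "b h i = tp i" if "i \<in> N" "sel i h = {}" for i h
    using that by (simp add: b_def SAT_frontiers_def sel_def)
  have b_sel: "b h i \<in> sel i h" and b_min: "k \<in> sel i h \<Longrightarrow> (b h i, k) \<in> R i"
    if "i \<in> N" "sel i h \<noteq> {}" for i h k
  proof -
    have S: "finite (sel i h)" "sel i h \<subseteq> X i"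
      using sel_sub vals[OF that(1)] by (blast intro: finite_subset)+
    have "b h i = minimum_wrt (R i) (sel i h)"
      using that by (simp add: b_def SAT_frontiers_def sel_def)
    then show "b h i \<in> sel i h" and "k \<in> sel i h \<Longrightarrow> (b h i, k) \<in> R i"
      using minimum_wrt_linear_order[OF lin[OF that(1)] S(1) that(2) S(2)] by simp_all
  qed

  have b_in: "b h i \<in> X i" if "i \<in> N" "h \<in> {1..p-1}" for i h
  proof (cases "sel i h = {}")
    case True
    then show ?thesis using tp[OF that] b_empty[OF that(1)] unfolding sel_def by simp
  next
    case False
    then show ?thesis using b_sel[OF that(1)] sel_sub vals[OF that(1)] by blast
  qed
  have b_mono: "(b h i, b h' i) \<in> R i"
    if i: "i \<in> N" and h: "h \<in> {1..p-1}" "h' \<in> {1..p-1}" "h \<le> h'" for i h h'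
  \<comment> \<open>Clause (2) speaks only of \<open>h < h'\<close>; equal indices need
    reflexivity.\<close>
  proof (cases "h = h'")
    case True
    then show ?thesis using lin[OF i] b_in[OF i h(1)] by (auto simp: order_on_defs refl_on_def)
  next
    case False
    \<comment> \<open>Selected sets shrink as the frontier index grows, so their minima can only
      rise.\<close>
    have sub: "sel i h' \<subseteq> sel i h"
      using frontier_mono[OF i h(1,2)] h(3) False
      by (auto simp: sel_def selected_values_def)
    show ?thesis
    proof (cases "sel i h' = {}")
      case True
      \<comment> \<open>The later frontier sits at the default \<open>tp i\<close>. The earlier one
        is either that same default or a reference value, and \<open>tp i\<close> lies above all of
        those.\<close>
      have "(b h i, tp i) \<in> R i"
      proof (cases "sel i h = {}")
        case True
        then show ?thesis
          using b_empty[OF i True] b_in[OF i h(1)] lin[OF i]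
          by (auto simp: order_on_defs refl_on_def)
      next
        case False
        then have "b h i \<in> values_on Xs i" using b_sel[OF i] sel_sub by blast
        then show ?thesis using tp[OF i h(2)] True by (simp add: sel_def)
      qed
      then show ?thesis using b_empty[OF i True] by simp
    next
      case False
      then show ?thesis using b_sel[OF i False] b_min[OF i] sub by blast
    qed
  qed
  have nondecreasing: "nondecreasing_profiles N X R p b"
    unfolding nondecreasing_profiles_def weakly_dominates_def outranking_coalition_def
    \<comment> \<open>Membership in \<open>PiE N X\<close> also asks for extensionality, which
      \<open>b h\<close> gets from the restricted lambda in \<open>SAT_frontiers\<close>.\<close>
    using b_in b_mono by (auto simp: PiE_iff) (auto simp: b_def SAT_frontiers_def)
  have upset: "upset_of_coalitions N T"
    using coalition_mono unfolding upset_of_coalitions_def T_def by blast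

  have outranks_iff: "(b h i, u i) \<in> R i \<longleftrightarrow> x i h (u i)"
    if i: "i \<in> N" and h: "h \<in> {1..p-1}" and u: "u \<in> Xs" for i h u
  proof -
    have ui: "u i \<in> values_on Xs i" using u by (simp add: values_on_def)
    show ?thesis
    proof (cases "sel i h = {}")
      case True
      \<comment> \<open>With nothing selected both sides are false: \<open>tp i\<close> is strictly
        above \<open>u i\<close>, so antisymmetry rules out the reverse comparison.\<close>
      then have "(u i, tp i) \<in> R i" "u i \<noteq> tp i"
        using tp[OF i h] ui by (simp_all add: sel_def)
      then have "(b h i, u i) \<notin> R i"
        using lin[OF i] b_empty[OF i True] by (auto simp: order_on_defs dest: antisymD)
      then show ?thesis using True ui by (auto simp: sel_def selected_values_def)
    next
      case False
      \<comment> \<open>Left to right, clause (1) propagates selection upward from the minimum,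
        itself a selected reference value; right to left is minimality.\<close>
      then have "b h i \<in> values_on Xs i" "x i h (b h i)"
        using b_sel[OF i False] by (auto simp: sel_def selected_values_def)
      then show ?thesis
        using upward[OF i h] b_min[OF i False] ui
        by (auto simp: sel_def selected_values_def)
    qed
  qed
  have outranking: "outranking_coalition N R u (b h) = {i \<in> N. x i h (u i)}"
    if "h \<in> {1..p-1}" "u \<in> Xs" for h u
    using outranks_iff[OF _ that] by (auto simp: outranking_coalition_def)
  have "U_NCS N R p b T u = A u" if u: "u \<in> Xs" for u
  proof (rule U_NCS_eqI[OF lin assms(3) nondecreasing upset])
    show Ap: "A u < p" using assms(6) u by auto
    let ?O = "\<lambda>h. outranking_coalition N R u (b h)"
    show "?O (A u) \<in> T" if "A u \<noteq> 0"
    proof -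
      have h: "A u \<in> {1..p-1}" using that Ap by auto
      \<comment> \<open>No criterion outside the outranking coalition has its \<open>x\<close>
        variable true, so the first disjunct of clause (5) fails.\<close>
      have "y (N - (N - ?O (A u)))"
        using above[of "N - ?O (A u)" "A u" u] h u outranking[OF h u] by blast
      moreover have "?O (A u) \<subseteq> N" by (auto simp: outranking_coalition_def)
      ultimately show ?thesis by (simp add: T_def double_diff)
    qed
    show "?O (A u + 1) \<notin> T" if "A u \<noteq> p - 1"
    proof -
      \<comment> \<open>Clause (4) at \<open>h\<close> concerns category \<open>h - 1\<close>, hence
        the shift; \<open>A u\<close> is not the top category, so this frontier exists.\<close>
      have h: "A u + 1 \<in> {1..p-1}" using that Ap by auto
      show ?thesis
        using below[of "?O (A u + 1)" "A u + 1" u] h u outranking[OF h u]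
        by (auto simp: T_def)
    qed
  qed
  then have "extends_assignment (U_NCS N R p b T) Xs A"
    by (simp add: extends_assignment_def)
  then show ?thesis using nondecreasing upset unfolding b_def T_def by blast
qed

end
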